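(* Fix integers $t,\ell\ge 0$. Let $\mathbf{x}$ and $\mathbf{y}$ be sets of indeterminates, and for $n\ge 0$ and $0\le i\le \ell$ let $a^{(i)}_n(\mathbf{x})\in\mathbb{R}[\mathbf{x}]$ and $b_n(\mathbf{y})\in\mathbb{R}[\mathbf{y}]$ be polynomials with nonnegative coefficients. Let $M=[M_{n,k}]_{n,k\ge0}$ be the weighted lattice path matrix and $\mathcal{A}$ the weight matrix defined in the context. Then: (i) if $\mathcal{A}$ is $\mathbf{x}$-totally positive of order $r$, then $M$ is $(\mathbf{x},\mathbf{y})$-totally positive of order $r$; (ii) if $\mathcal{A}$ is $\mathbf{x}$-totally positive, then $M$ is $(\mathbf{x},\mathbf{y})$-totally positive.
   Context: For $n,k\ge0$, $M_{n,k}$ is the sum of the weights of all lattice paths in $\mathbb{N}^2$ from $(0,0)$ to $(k,n)$ using the steps $(0,1)$ and $(1,t+i)$ for $0\le i\le\ell$, where each step $(0,1)$ starting at height $n-1$ (ending at height $n$) gets weight $b_n(\mathbf{y})$, each step $(1,t+i)$ starting at height $n-t-i$ (ending at height $n$) gets weight $a^{(i)}_n(\mathbf{x})$, and the weight of a path is the product of the weights of its steps (the empty path has weight $1$). The matrix $\mathcal{A}=[\mathcal{A}_{i,j}]_{i,j\ge0}$ is the infinite lower triangular matrix with $\mathcal{A}_{i,j}=a_i^{(i-j)}(\mathbf{x})$ if $i-\ell\le j\le i$ and $\mathcal{A}_{i,j}=0$ otherwise. For a set of indeterminates $\mathbf{z}$, a matrix with entries in $\mathbb{R}[\mathbf{z}]$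 is $\mathbf{z}$-totally positive if all its minors are polynomials with nonnegative coefficients in $\mathbf{z}$, and $\mathbf{z}$-totally positive of order $r$ if all its minors of order $k\le r$ are polynomials with nonnegative coefficients in $\mathbf{z}$. *)

theory Defs
  imports "HOL-Library.Poly_Mapping" "Jordan_Normal_Form.Determinant"
begin

text \<open>A monomial is a finitely supported exponent function \<open>'v \<Rightarrow>\<^sub>0 nat\<close> and a polynomial a finitely
  supported family of real coefficients indexed by monomials; the multiplication that
  \<^theory>\<open>HOL-Library.Poly_Mapping\<close> puts on this type is convolution, i.e. polynomial multiplication.\<close>

type_synonym 'v rpoly = "('v \<Rightarrow>\<^sub>0 nat) \<Rightarrow>\<^sub>0 real"

definition polys_in :: "'v set \<Rightarrow> 'v rpoly set" where
  "polys_in Z = {p. \<forall>m \<in> Poly_Mapping.keys p. Poly_Mapping.keys m \<subseteq> Z}"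

definition nonneg_coeffs :: "'v rpoly \<Rightarrow> bool" where
  "nonneg_coeffs p \<longleftrightarrow> (\<forall>m. 0 \<le> Poly_Mapping.lookup p m)"

text \<open>Infinite matrices are functions of the row and the column index. A minor of order \<open>k\<close> is given
  by strictly increasing choices of \<open>k\<close> rows and \<open>k\<close> columns; only the values of \<open>R\<close> and \<open>C\<close> below
  \<open>k\<close> matter.\<close>

definition minor :: "(nat \<Rightarrow> nat \<Rightarrow> 'a :: comm_ring_1) \<Rightarrow> nat \<Rightarrow> (nat \<Rightarrow> nat) \<Rightarrow> (nat \<Rightarrow> nat) \<Rightarrow> 'a" where
  "minor A k R C = det (mat k k (\<lambda>(i, j). A (R i) (C j)))"

definition totally_positive_of_order ::
    "'v set \<Rightarrow> nat \<Rightarrow> (nat \<Rightarrow> nat \<Rightarrow> 'v rpoly) \<Rightarrow> bool" where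
  "totally_positive_of_order Z r A \<longleftrightarrow>
     (\<forall>i j. A i j \<in> polys_in Z) \<and>
     (\<forall>k \<le> r. \<forall>R C. strict_mono_on {..<k} R \<longrightarrow> strict_mono_on {..<k} C \<longrightarrow>
        minor A k R C \<in> polys_in Z \<and> nonneg_coeffs (minor A k R C))"

definition totally_positive :: "'v set \<Rightarrow> (nat \<Rightarrow> nat \<Rightarrow> 'v rpoly) \<Rightarrow> bool" where
  "totally_positive Z A \<longleftrightarrow>
     (\<forall>i j. A i j \<in> polys_in Z) \<and>
     (\<forall>k R C. strict_mono_on {..<k} R \<longrightarrow> strict_mono_on {..<k} C \<longrightarrow>
        minor A k R C \<in> polys_in Z \<and> nonneg_coeffs (minor A k R C))"

text \<open>A path starting at the origin is the list of its steps, each step being a vector in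
  \<open>nat \<times> nat\<close>. All steps have nonnegative coordinates, so a path never leaves the quadrant.\<close>

definition steps :: "nat \<Rightarrow> nat \<Rightarrow> (nat \<times> nat) set" where
  "steps t l = {(0, 1)} \<union> {(1, t + i) | i. i \<le> l}"

definition lattice_paths :: "nat \<Rightarrow> nat \<Rightarrow> nat \<Rightarrow> nat \<Rightarrow> (nat \<times> nat) list set" where
  "lattice_paths t l k n =
     {p. set p \<subseteq> steps t l \<and> sum_list (map fst p) = k \<and> sum_list (map snd p) = n}"

text \<open>The argument \<open>n\<close> is the height at which the step ends, and \<open>a n i\<close> stands for $a_n^{(i)}$; a step
  \<open>(1, d)\<close> has \<open>d = t + i\<close>, so its index is \<open>i = d - t\<close>.\<close>

definition step_weight ::
    "nat \<Rightarrow> (nat \<Rightarrow> nat \<Rightarrow> 'a) \<Rightarrow> (nat \<Rightarrow> 'a) \<Rightarrow> nat \<times> nat \<Rightarrow> nat \<Rightarrow> 'a" where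
  "step_weight t a b s n = (if s = (0, 1) then b n else a n (snd s - t))"

text \<open>Here \<open>h\<close> is the height at which the path starts.\<close>

primrec path_weight ::
    "nat \<Rightarrow> (nat \<Rightarrow> nat \<Rightarrow> 'a :: comm_monoid_mult) \<Rightarrow> (nat \<Rightarrow> 'a) \<Rightarrow> nat \<Rightarrow> (nat \<times> nat) list \<Rightarrow> 'a" where
  "path_weight t a b h [] = 1"
| "path_weight t a b h (s # p) =
     step_weight t a b s (h + snd s) * path_weight t a b (h + snd s) p"

definition path_matrix ::
    "nat \<Rightarrow> nat \<Rightarrow> (nat \<Rightarrow> nat \<Rightarrow> 'a :: comm_semiring_1) \<Rightarrow> (nat \<Rightarrow> 'a) \<Rightarrow> nat \<Rightarrow> nat \<Rightarrow> 'a" where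
  "path_matrix t l a b n k = (\<Sum>p \<in> lattice_paths t l k n. path_weight t a b 0 p)"

text \<open>The band condition \<open>i - l \<le> j\<close> is an inequality between integers, hence written without
  truncated subtraction.\<close>

definition weight_matrix :: "nat \<Rightarrow> (nat \<Rightarrow> nat \<Rightarrow> 'a :: zero) \<Rightarrow> nat \<Rightarrow> nat \<Rightarrow> 'a" where
  "weight_matrix l a i j = (if i \<le> j + l \<and> j \<le> i then a i (i - j) else 0)"

text \<open>The sum defining \<^const>\<open>path_matrix\<close> is finite, so it is not the default value \<open>0\<close>.\<close>

lemma finite_lattice_paths: "finite (lattice_paths t l k n)"
proof -
  have len: "length p \<le> sum_list (map fst p) + sum_list (map snd p)"
    if "set p \<subseteq> steps t l" for p
    using that by (induction p) (auto simp: steps_def)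
  have "{(1, t + i) | i. i \<le> l} = (\<lambda>i. (1, t + i)) ` {..l}"
    by auto
  then have "finite (steps t l)"
    by (simp add: steps_def)
  then have "finite {p. set p \<subseteq> steps t l \<and> length p \<le> k + n}"
    by (rule finite_lists_length_le)
  then show ?thesis
    by (rule rev_finite_subset) (use len in \<open>auto simp: lattice_paths_def\<close>)
qed

end

theory Submission
  imports Defs
begin

text \<open>Decomposing paths by their last step gives \<open>M = P N\<close>. Here \<open>P\<close> is the inverse of the lower
  bidiagonal matrix with unit diagonal and subdiagonal entries \<open>- b n\<close>, and \<open>N\<close> has first column
  \<open>(1, 0, 0, \<dots>)\<close> and remaining columns \<open>A S M\<close>, where \<open>A\<close> is the weight matrix and \<open>S\<close> shifts rows down by
  \<open>t\<close>. Shifting rows and adjoining a unit column only yield minors that are zero or minors of the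
  original matrix, and minors of \<open>P\<close> are zero or products of the \<open>b n\<close>. Hence, by the Cauchy--Binet
  formula, total positivity of the first \<open>K\<close> columns of \<open>M\<close> passes to the first \<open>K + 1\<close> columns.\<close>

section \<open>Minors\<close>

lemma minor_cong:
  assumes "\<And>i j. i < k \<Longrightarrow> j < k \<Longrightarrow> A (R i) (C j) = B (R' i) (C' j)"
  shows "minor A k R C = minor B k R' C'"
  unfolding minor_def using assms by (intro arg_cong[where f = det] eq_matI) auto

lemma minor_0 [simp]: "minor A 0 R C = 1"
  by (simp add: minor_def)

lemma minor_transpose: "minor (\<lambda>i j. A j i) k C R = minor A k R C"
proof -
  have "mat k k (\<lambda>(i, j). A (R j) (C i)) = transpose_mat (mat k k (\<lambda>(i, j). A (R i) (C j)))"
    by (rule eq_matI) auto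
  then show ?thesis
    unfolding minor_def by (simp add: det_transpose[of _ k])
qed

lemma minor_permute_rows:
  assumes "p permutes {0..<k}"
  shows "minor A k (R \<circ> p) C = signof p * minor A k R C"
proof -
  have "p i < k" if "i < k" for i
    using permutes_in_image[OF assms, of i] that by simp
  then have eq: "mat k k (\<lambda>(i, j). A ((R \<circ> p) i) (C j)) =
      mat k k (\<lambda>(i, j). mat k k (\<lambda>(i, j). A (R i) (C j)) $$ (p i, j))"
    by (intro eq_matI) auto
  show ?thesis
    unfolding minor_def eq by (rule det_permute_rows[OF _ assms]) simp
qed

lemma minor_identical_rows:
  assumes "\<not> inj_on R {0..<k}"
  shows "minor A k R C = 0"
proof -
  obtain i j where ij: "i < k" "j < k" "i \<noteq> j" "R i = R j"
    using assms by (auto simp: inj_on_def)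
  show ?thesis
    unfolding minor_def
    by (rule det_identical_rows[of _ k i j]) (use ij in \<open>auto intro!: eq_vecI\<close>)
qed

text \<open>Every product in the Leibniz formula contains a factor from row
  \<open>i\<close>.\<close>

lemma minor_zero_row:
  assumes "i < k" "\<And>j. j < k \<Longrightarrow> A (R i) (C j) = 0"
  shows "minor A k R C = 0"
proof -
  have "(\<Prod>j = 0..<k. A (R j) (C (p j))) = 0" if "p permutes {0..<k}" for p
    using assms permutes_in_image[OF that, of i] by (intro prod_zero bexI[of _ i]) auto
  then show ?thesis
    unfolding minor_def by (subst det_def'[of _ k]) (auto intro!: sum.neutral)
qed

text \<open>Laplace expansion along the first column: only the top entry survives, and its cofactor
  has sign +1.\<close>

lemma minor_Suc_column:
  assumes "\<And>i. 0 < i \<Longrightarrow> i \<le> k \<Longrightarrow> A (R i) (C 0) = 0"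
  shows "minor A (Suc k) R C = A (R 0) (C 0) * minor A k (R \<circ> Suc) (C \<circ> Suc)"
proof -
  let ?M = "mat (Suc k) (Suc k) (\<lambda>(i, j). A (R i) (C j))"
  have "mat_delete ?M 0 0 = mat k k (\<lambda>(i, j). A ((R \<circ> Suc) i) ((C \<circ> Suc) j))"
    by (rule eq_matI) (auto simp: mat_delete_def)
  moreover have "det ?M = (\<Sum>i<Suc k. ?M $$ (i, 0) * cofactor ?M i 0)"
    by (rule laplace_expansion_column) auto
  moreover have "(\<Sum>i<Suc k. ?M $$ (i, 0) * cofactor ?M i 0) = ?M $$ (0, 0) * cofactor ?M 0 0"
    using assms by (subst sum.remove[of _ 0]) (auto intro!: sum.neutral)
  ultimately show ?thesis
    by (simp add: minor_def cofactor_def)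
qed

lemma minor_Suc_row:
  assumes "\<And>j. 0 < j \<Longrightarrow> j \<le> k \<Longrightarrow> A (R 0) (C j) = 0"
  shows "minor A (Suc k) R C = A (R 0) (C 0) * minor A k (R \<circ> Suc) (C \<circ> Suc)"
  using minor_Suc_column[of k "\<lambda>i j. A j i" C R] assms
  by (simp add: minor_transpose[of A])

text \<open>Clearing column \<open>i\<close> is undone by adding \<open>c\<close> times column
  \<open>j\<close>, which preserves the determinant. A zero column becomes a zero row after
  transposition.\<close>

lemma minor_proportional_columns:
  assumes "i < k" "j < k" "i \<noteq> j" "\<And>m. m < k \<Longrightarrow> A (R m) (C i) = c * A (R m) (C j)"
  shows "minor A k R C = 0"
proof -
  let ?M = "mat k k (\<lambda>(m, n). A (R m) (C n))"
  let ?N = "mat k k (\<lambda>(m, n). if n = i then 0 else A (R m) (C n))"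
  have "?M = addcol c i j ?N"
    using assms by (intro eq_matI) auto
  then have "det ?M = det ?N"
    using assms by (simp add: det_addcol[of _ k])
  also have "\<dots> = minor (\<lambda>n m. if n = i then 0 else A (R m) (C n)) k (\<lambda>i. i) (\<lambda>i. i)"
    using minor_transpose[of "\<lambda>n m. if n = i then 0 else A (R m) (C n)" k "\<lambda>i. i" "\<lambda>i. i"]
    by (simp add: minor_def)
  also have "\<dots> = 0"
    using assms(1) by (rule minor_zero_row) simp
  finally show ?thesis
    by (simp add: minor_def)
qed

section \<open>The Cauchy--Binet formula\<close>

definition enum :: "nat set \<Rightarrow> nat \<Rightarrow> nat" where
  "enum S i = sorted_list_of_set S ! i"

lemma strict_mono_on_enum: "finite S \<Longrightarrow> card S = k \<Longrightarrow> strict_mono_on {..<k} (enum S)"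
  using sorted_wrt_nth_less[OF strict_sorted_list_of_set, of _ _ S]
  by (auto simp: enum_def strict_mono_on_def)

lemma bij_betw_enum: "finite S \<Longrightarrow> card S = k \<Longrightarrow> bij_betw (enum S) {0..<k} S"
  unfolding enum_def by (rule bij_betw_nth) auto

text \<open>A bijection from \<open>{0..<k}\<close> onto \<open>S\<close> is the increasing
  enumeration of \<open>S\<close> preceded by a unique permutation. \<open>restrict\<close> supplies
  the default value outside \<open>{0..<k}\<close> that extensional functions carry.\<close>

lemma sum_inj_image_eq_permutations:
  assumes "finite S" "card S = k"
  shows "(\<Sum>f \<in> {f \<in> {0..<k} \<rightarrow>\<^sub>E S. inj_on f {0..<k} \<and> f ` {0..<k} = S}. h f) =
    (\<Sum>p | p permutes {0..<k}. h (restrict (enum S \<circ> p) {0..<k}))"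
proof (rule sum.reindex_bij_betw[symmetric], rule bij_betwI')
  note bij = bij_betw_enum[OF assms]
  fix p q assume p: "p \<in> {p. p permutes {0..<k}}" and q: "q \<in> {p. p permutes {0..<k}}"
  have "p = q" if eq: "restrict (enum S \<circ> p) {0..<k} = restrict (enum S \<circ> q) {0..<k}"
  proof
    fix i
    show "p i = q i"
    proof (cases "i < k")
      case True
      then have "enum S (p i) = enum S (q i)"
        using fun_cong[OF eq, of i] by simp
      moreover have "p i \<in> {0..<k}" "q i \<in> {0..<k}"
        using p q True permutes_in_image[of _ "{0..<k}" i] by auto
      ultimately show ?thesis
        using bij by (auto simp: bij_betw_def dest: inj_onD)
    next
      case False
      then show ?thesis
        using p q by (simp add: permutes_not_in[of _ "{0..<k}"])
    qed
  qed
  then show "(restrict (enum S \<circ> p) {0..<k} = restrict (enum S \<circ> q) {0..<k}) = (p = q)"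
    by auto
next
  note bij = bij_betw_enum[OF assms]
  fix p assume "p \<in> {p. p permutes {0..<k}}"
  then have "bij_betw (enum S \<circ> p) {0..<k} S"
    using bij by (auto intro: bij_betw_trans permutes_imp_bij)
  then show "restrict (enum S \<circ> p) {0..<k} \<in>
      {f \<in> {0..<k} \<rightarrow>\<^sub>E S. inj_on f {0..<k} \<and> f ` {0..<k} = S}"
    by (auto simp: bij_betw_def inj_on_def)
next
  note bij = bij_betw_enum[OF assms]
  fix f assume f: "f \<in> {f \<in> {0..<k} \<rightarrow>\<^sub>E S. inj_on f {0..<k} \<and> f ` {0..<k} = S}"
  \<comment> \<open>\<open>permutes\<close> demands the identity outside
    \<open>{0..<k}\<close>.\<close>
  define p where "p i = (if i < k then the_inv_into {0..<k} (enum S) (f i) else i)" for i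
  have "bij_betw (the_inv_into {0..<k} (enum S) \<circ> f) {0..<k} {0..<k}"
    using f bij_betw_the_inv_into[OF bij] by (intro bij_betw_trans) (auto simp: bij_betw_def)
  moreover have "bij_betw p {0..<k} {0..<k} \<longleftrightarrow>
      bij_betw (the_inv_into {0..<k} (enum S) \<circ> f) {0..<k} {0..<k}"
    by (rule bij_betw_cong) (simp add: p_def)
  ultimately have "p permutes {0..<k}"
    by (intro bij_imp_permutes) (simp_all add: p_def)
  moreover have "f = restrict (enum S \<circ> p) {0..<k}"
  proof
    fix i show "f i = restrict (enum S \<circ> p) {0..<k} i"
      using f bij f_the_inv_into_f_bij_betw[OF bij, of "f i"]
      by (cases "i < k") (auto simp: p_def PiE_def extensional_def)
  qed
  ultimately show "\<exists>p \<in> {p. p permutes {0..<k}}. f = restrict (enum S \<circ> p) {0..<k}"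
    by blast
qed

text \<open>Distributing the product in the Leibniz formula over the inner sums gives a sum over
  choice functions \<open>f\<close>. For fixed \<open>f\<close>, the sum over permutations is the
  minor of \<open>B\<close> with rows chosen by \<open>f\<close>.\<close>

theorem cauchy_binet:
  "minor (\<lambda>i j. \<Sum>s<m. A i s * B s j) k R C =
     (\<Sum>S | S \<subseteq> {..<m} \<and> card S = k. minor A k R (enum S) * minor B k (enum S) C)"
proof -
  let ?I = "{0..<k}" and ?F = "{0..<k} \<rightarrow>\<^sub>E {..<m}" and ?T = "{S. S \<subseteq> {..<m} \<and> card S = k}"
  define h where "h f = (\<Prod>i\<in>?I. A (R i) (f i)) * minor B k f C" for f
  have finF: "finite ?F"
    by (intro finite_PiE) auto
  have finT: "finite ?T"
    by (rule finite_subset[of _ "Pow {..<m}"]) auto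
  have "minor (\<lambda>i j. \<Sum>s<m. A i s * B s j) k R C =
      (\<Sum>p | p permutes ?I. signof p * (\<Prod>i\<in>?I. \<Sum>s<m. A (R i) s * B s (C (p i))))"
    unfolding minor_def
    by (subst det_def'[of _ k]) (auto intro!: sum.cong prod.cong arg_cong2[where f = "(*)"])
  also have "\<dots> = (\<Sum>p | p permutes ?I. \<Sum>f\<in>?F.
      signof p * (\<Prod>i\<in>?I. A (R i) (f i) * B (f i) (C (p i))))"
    by (subst prod_sum_PiE) (auto simp: sum_distrib_left)
  also have "\<dots> = (\<Sum>f\<in>?F. \<Sum>p | p permutes ?I.
      signof p * (\<Prod>i\<in>?I. A (R i) (f i) * B (f i) (C (p i))))"
    by (rule sum.swap)
  also have "\<dots> = (\<Sum>f\<in>?F. h f)"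
    unfolding h_def minor_def
    by (subst det_def'[of _ k])
      (auto intro!: sum.cong prod.cong simp: sum_distrib_left prod.distrib mult.left_commute)
  \<comment> \<open>A choice function that is not injective repeats a row of
    \<open>B\<close>.\<close>
  also have "\<dots> = (\<Sum>f \<in> {f \<in> ?F. inj_on f ?I}. h f)"
    using finF by (intro sum.mono_neutral_right) (auto simp: h_def minor_identical_rows)
  also have "\<dots> = (\<Sum>S\<in>?T. \<Sum>f | f \<in> {f \<in> ?F. inj_on f ?I} \<and> f ` ?I = S. h f)"
    using finF finT by (intro sum.group[symmetric]) (auto simp: card_image)
  also have "\<dots> = (\<Sum>S\<in>?T. minor A k R (enum S) * minor B k (enum S) C)"
  proof (rule sum.cong[OF refl])
    fix S assume S: "S \<in> ?T"
    then have fin: "finite S" "card S = k"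
      by (auto intro: finite_subset)
    have "{f \<in> {f \<in> ?F. inj_on f ?I}. f ` ?I = S} =
        {f \<in> ?I \<rightarrow>\<^sub>E S. inj_on f ?I \<and> f ` ?I = S}"
      using S by (auto simp: PiE_iff)
    then have "(\<Sum>f | f \<in> {f \<in> ?F. inj_on f ?I} \<and> f ` ?I = S. h f) =
        (\<Sum>p | p permutes ?I. h (restrict (enum S \<circ> p) ?I))"
      using sum_inj_image_eq_permutations[OF fin, of h] by simp
    also have "\<dots> = (\<Sum>p | p permutes ?I.
        (\<Prod>i\<in>?I. A (R i) (enum S (p i))) * (signof p * minor B k (enum S) C))"
    proof (rule sum.cong[OF refl])
      fix p assume "p \<in> {p. p permutes ?I}"
      then have "minor B k (enum S \<circ> p) C = signof p * minor B k (enum S) C"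
        by (simp add: minor_permute_rows)
      moreover have "minor B k (restrict (enum S \<circ> p) ?I) C = minor B k (enum S \<circ> p) C"
        by (rule minor_cong) simp
      ultimately show "h (restrict (enum S \<circ> p) ?I) =
          (\<Prod>i\<in>?I. A (R i) (enum S (p i))) * (signof p * minor B k (enum S) C)"
        by (simp add: h_def)
    qed
    \<comment> \<open>The signs from sorting the rows of \<open>B\<close> are those of the Leibniz
      formula for the minor of \<open>A\<close>.\<close>
    also have "\<dots> = minor A k R (enum S) * minor B k (enum S) C"
      unfolding minor_def
      by (subst det_def'[of "mat k k (\<lambda>(i, j). A (R i) (enum S j))" k])
        (auto intro!: sum.cong prod.cong simp: sum_distrib_left sum_distrib_right mult_ac)
    finally show "(\<Sum>f | f \<in> {f \<in> ?F. inj_on f ?I} \<and> f ` ?I = S. h f) =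
        minor A k R (enum S) * minor B k (enum S) C" .
  qed
  finally show ?thesis .
qed

section \<open>Matrices whose minors lie in a subsemiring\<close>

definition minors_in :: "'a :: comm_ring_1 set \<Rightarrow> nat \<Rightarrow> (nat \<Rightarrow> nat \<Rightarrow> 'a) \<Rightarrow> bool" where
  "minors_in Q r A \<longleftrightarrow> (\<forall>k \<le> r. \<forall>R C. strict_mono_on {..<k} R \<longrightarrow> strict_mono_on {..<k} C \<longrightarrow>
     minor A k R C \<in> Q)"

lemma minors_inI:
  "(\<And>k R C. k \<le> r \<Longrightarrow> strict_mono_on {..<k} R \<Longrightarrow> strict_mono_on {..<k} C \<Longrightarrow> minor A k R C \<in> Q)
   \<Longrightarrow> minors_in Q r A"
  by (simp add: minors_in_def)

lemma minors_inD:
  "minors_in Q r A \<Longrightarrow> k \<le> r \<Longrightarrow> strict_mono_on {..<k} R \<Longrightarrow> strict_mono_on {..<k} C \<Longrightarrow>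
   minor A k R C \<in> Q"
  by (simp add: minors_in_def)

lemma minors_in_mono: "Q \<subseteq> Q' \<Longrightarrow> minors_in Q r A \<Longrightarrow> minors_in Q' r A"
  by (auto simp: minors_in_def)

lemma strict_mono_on_Suc: "strict_mono_on {..<Suc k} R \<Longrightarrow> strict_mono_on {..<k} (R \<circ> Suc)"
  by (auto simp: strict_mono_on_def)

lemma strict_mono_on_diff:
  fixes R :: "nat \<Rightarrow> nat"
  assumes "strict_mono_on {..<k} R" "\<And>i. i < k \<Longrightarrow> t \<le> R i"
  shows "strict_mono_on {..<k} (\<lambda>i. R i - t)"
  using assms by (auto simp: strict_mono_on_def diff_less_mono)

text \<open>The entry \<open>(i, j)\<close> is the weight of the vertical path from height \<open>j\<close> to height \<open>i\<close>.\<close>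

definition vertical_matrix :: "(nat \<Rightarrow> 'a :: comm_ring_1) \<Rightarrow> nat \<Rightarrow> nat \<Rightarrow> 'a" where
  "vertical_matrix b i j = (if j \<le> i then prod b {Suc j..i} else 0)"

definition shift_rows :: "nat \<Rightarrow> (nat \<Rightarrow> nat \<Rightarrow> 'a :: comm_ring_1) \<Rightarrow> nat \<Rightarrow> nat \<Rightarrow> 'a" where
  "shift_rows t A i j = (if i < t then 0 else A (i - t) j)"

text \<open>In the path matrix factorization, the unit column accounts for the empty path and the
  index shift for the unit of width of a step \<open>(1, t + i)\<close>.\<close>

definition cons_unit_column :: "(nat \<Rightarrow> nat \<Rightarrow> 'a :: comm_ring_1) \<Rightarrow> nat \<Rightarrow> nat \<Rightarrow> 'a" where
  "cons_unit_column A i j = (case j of 0 \<Rightarrow> of_bool (i = 0) | Suc j \<Rightarrow> A i j)"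

text \<open>Nonnegative polynomials are not closed under negation, so minors must be treated by
  identities free of signs.\<close>

locale subsemiring =
  fixes Q :: "'a :: comm_ring_1 set"
  assumes zero_closed: "0 \<in> Q"
    and one_closed: "1 \<in> Q"
    and add_closed: "x \<in> Q \<Longrightarrow> y \<in> Q \<Longrightarrow> x + y \<in> Q"
    and mult_closed: "x \<in> Q \<Longrightarrow> y \<in> Q \<Longrightarrow> x * y \<in> Q"
begin

section \<open>Operations that keep minors in a subsemiring\<close>

lemma sum_closed: "(\<And>i. i \<in> I \<Longrightarrow> f i \<in> Q) \<Longrightarrow> sum f I \<in> Q"
  by (induction I rule: infinite_finite_induct) (auto intro: zero_closed add_closed)

lemma prod_closed: "(\<And>i. i \<in> I \<Longrightarrow> f i \<in> Q) \<Longrightarrow> prod f I \<in> Q"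
  by (induction I rule: infinite_finite_induct) (auto intro: one_closed mult_closed)

lemma minors_in_mult:
  assumes A: "minors_in Q r A" and B: "minors_in Q r B" and lower: "\<And>i j. i < j \<Longrightarrow> A i j = 0"
  shows "minors_in Q r (\<lambda>i j. \<Sum>s\<le>i. A i s * B s j)"
proof (rule minors_inI)
  fix k and R C :: "nat \<Rightarrow> nat"
  assume k: "k \<le> r" and R: "strict_mono_on {..<k} R" and C: "strict_mono_on {..<k} C"
  \<comment> \<open>The sum bounds every \<open>R i\<close>. As \<open>A\<close> is lower
    triangular, all selected rows can be summed over the same range \<open>{..<m}\<close>, as
    Cauchy--Binet requires.\<close>
  define m where "m = Suc (\<Sum>i<k. R i)"
  have "(\<Sum>s\<le>R i. A (R i) s * B s j) = (\<Sum>s<m. A (R i) s * B s j)" if "i < k" for i j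
  proof (rule sum.mono_neutral_left)
    have "R i \<le> (\<Sum>i<k. R i)"
      using that by (intro member_le_sum) auto
    then show "{..R i} \<subseteq> {..<m}"
      by (auto simp: m_def)
  qed (auto simp: lower)
  then have "minor (\<lambda>i j. \<Sum>s\<le>i. A i s * B s j) k R C =
      minor (\<lambda>i j. \<Sum>s<m. A i s * B s j) k R C"
    by (intro minor_cong)
  also have "\<dots> \<in> Q"
    unfolding cauchy_binet
  proof (intro sum_closed mult_closed)
    fix S assume "S \<in> {S. S \<subseteq> {..<m} \<and> card S = k}"
    then have "strict_mono_on {..<k} (enum S)"
      by (auto intro: strict_mono_on_enum finite_subset)
    then show "minor A k R (enum S) \<in> Q" "minor B k (enum S) C \<in> Q"
      using k R C A B by (auto intro: minors_inD)
  qed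
  finally show "minor (\<lambda>i j. \<Sum>s\<le>i. A i s * B s j) k R C \<in> Q" .
qed

lemma minors_in_shift_rows:
  assumes "minors_in Q r A"
  shows "minors_in Q r (shift_rows t A)"
proof (rule minors_inI)
  fix k and R C :: "nat \<Rightarrow> nat"
  assume k: "k \<le> r" and R: "strict_mono_on {..<k} R" and C: "strict_mono_on {..<k} C"
  show "minor (shift_rows t A) k R C \<in> Q"
  proof (cases "\<exists>i<k. R i < t")
    case True
    then obtain i where "i < k" "R i < t"
      by blast
    then have "minor (shift_rows t A) k R C = 0"
      by (intro minor_zero_row[of i]) (auto simp: shift_rows_def)
    then show ?thesis
      by (simp add: zero_closed)
  next
    case False
    then have "minor (shift_rows t A) k R C = minor A k (\<lambda>i. R i - t) C"
      by (intro minor_cong) (auto simp: shift_rows_def)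
    moreover have "strict_mono_on {..<k} (\<lambda>i. R i - t)"
      using R False by (intro strict_mono_on_diff) auto
    ultimately show ?thesis
      using assms k C by (auto intro: minors_inD)
  qed
qed

lemma minors_in_cons_unit_column:
  assumes "minors_in Q r A"
  shows "minors_in Q r (cons_unit_column A)"
proof (rule minors_inI)
  \<comment> \<open>Without column 0, this is a minor of \<open>A\<close> with column indices
    lowered by one.\<close>
  have positive: "minor (cons_unit_column A) k R C \<in> Q"
    if "k \<le> r" "strict_mono_on {..<k} R" "strict_mono_on {..<k} C" "\<And>i. i < k \<Longrightarrow> 1 \<le> C i"
    for k and R C :: "nat \<Rightarrow> nat"
  proof -
    have "minor (cons_unit_column A) k R C = minor A k R (\<lambda>j. C j - 1)"
      using that(4) by (intro minor_cong) (force simp: cons_unit_column_def split: nat.split)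
    then show ?thesis
      using assms that strict_mono_on_diff[of k C 1] by (auto intro: minors_inD)
  qed
  fix k and R C :: "nat \<Rightarrow> nat"
  assume k: "k \<le> r" and R: "strict_mono_on {..<k} R" and C: "strict_mono_on {..<k} C"
  show "minor (cons_unit_column A) k R C \<in> Q"
  proof (cases "k > 0 \<and> C 0 = 0")
    case True
    then obtain k' where k': "k = Suc k'"
      using gr0_implies_Suc by blast
    \<comment> \<open>By strict monotonicity, only the first selected row can be row 0, and only the
      first selected column is column 0. Hence that column vanishes below its top entry, and
      deleting it leads to the case \<open>positive\<close>.\<close>
    have "R i > 0" "C i > 0" if "0 < i" "i \<le> k'" for i
      using strict_mono_onD[OF R, of 0 i] strict_mono_onD[OF C, of 0 i] that
      by (auto simp: k')
    then have "minor (cons_unit_column A) k R C =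
        of_bool (R 0 = 0) * minor (cons_unit_column A) k' (R \<circ> Suc) (C \<circ> Suc)"
      and "minor (cons_unit_column A) k' (R \<circ> Suc) (C \<circ> Suc) \<in> Q"
      using True k R C unfolding k'
      by (auto simp: cons_unit_column_def strict_mono_on_Suc Suc_le_eq
          intro!: minor_Suc_column[THEN trans] positive)
    then show ?thesis
      by (auto simp: zero_closed)
  next
    case False
    have "1 \<le> C i" if "i < k" for i
      using strict_mono_onD[OF C, of 0 i] that False by (cases i) auto
    then show ?thesis
      by (rule positive[OF k R C])
  qed
qed

text \<open>In a minor whose first row lies weakly below its second column, the first two columns are
  proportional; otherwise the first row has at most one nonzero entry.\<close>

lemma minors_in_vertical_matrix:
  assumes b: "\<And>n. b n \<in> Q"
  shows "minors_in Q r (vertical_matrix b)"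
proof (rule minors_inI)
  fix k :: nat and R C :: "nat \<Rightarrow> nat"
  assume "strict_mono_on {..<k} R" "strict_mono_on {..<k} C"
  then show "minor (vertical_matrix b) k R C \<in> Q"
  proof (induction k arbitrary: R C)
    case 0
    then show ?case
      by (simp add: one_closed)
  next
    case (Suc k)
    show ?case
    proof (cases "k > 0 \<and> C 1 \<le> R 0")
      case True
      have "C 0 < C 1"
        using strict_mono_onD[OF Suc.prems(2), of 0 1] True by simp
      \<comment> \<open>Every vertical path from height \<open>C 0\<close> to height
        \<open>R m\<close> passes through height \<open>C 1\<close>, because
        \<open>C 1 \<le> R 0 \<le> R m\<close>.\<close>
      have "vertical_matrix b (R m) (C 0) =
          prod b {Suc (C 0)..C 1} * vertical_matrix b (R m) (C 1)" if "m < Suc k" for m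
      proof -
        have "R 0 \<le> R m"
          using strict_mono_onD[OF Suc.prems(1), of 0 m] that by (cases m) auto
        then have "{Suc (C 0)..R m} = {Suc (C 0)..C 1} \<union> {Suc (C 1)..R m}"
          using True \<open>C 0 < C 1\<close> by auto
        then show ?thesis
          using True \<open>C 0 < C 1\<close> \<open>R 0 \<le> R m\<close>
          by (auto simp: vertical_matrix_def prod.union_disjoint)
      qed
      then have "minor (vertical_matrix b) (Suc k) R C = 0"
        using True by (intro minor_proportional_columns[of 0 _ 1]) auto
      then show ?thesis
        by (simp add: zero_closed)
    next
      case False
      have "\<not> C j \<le> R 0" if "0 < j" "j \<le> k" for j
        using strict_mono_onD[OF Suc.prems(2), of 1 j] that False by (cases "j = 1") auto
      then have "minor (vertical_matrix b) (Suc k) R C = vertical_matrix b (R 0) (C 0) *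
          minor (vertical_matrix b) k (R \<circ> Suc) (C \<circ> Suc)"
        by (intro minor_Suc_row) (simp add: vertical_matrix_def)
      moreover have "vertical_matrix b (R 0) (C 0) \<in> Q"
        using b by (auto simp: vertical_matrix_def intro: zero_closed prod_closed)
      ultimately show ?thesis
        using Suc by (auto intro!: mult_closed strict_mono_on_Suc)
    qed
  qed
qed

end

section \<open>Recursion for the path matrix\<close>

text \<open>\<open>path_weight\<close> peels off the first step, while the recursion for the path
  matrix needs the last one, whose weight depends on the total height reached.\<close>

lemma path_weight_snoc:
  "path_weight t a b h (p @ [s]) =
     path_weight t a b h p * step_weight t a b s (h + sum_list (map snd p) + snd s)"
  by (induction p arbitrary: h) (simp_all add: mult.assoc add.assoc)

text \<open>A path is empty or ends in a vertical step or in a step \<open>(1, t + i)\<close>. The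
  case distinctions keep the subtractions from truncating.\<close>

lemma lattice_paths_rec:
  "lattice_paths t l k n =
     (if k = 0 \<and> n = 0 then {[]} else {}) \<union>
     (if n = 0 then {} else (\<lambda>p. p @ [(0, 1)]) ` lattice_paths t l k (n - 1)) \<union>
     (if k = 0 then {} else
        (\<Union>i \<in> {i. i \<le> l \<and> t + i \<le> n}. (\<lambda>p. p @ [(1, t + i)]) ` lattice_paths t l (k - 1) (n - (t + i))))"
  (is "_ = ?S")
proof (rule Set.set_eqI)
  fix p :: "(nat \<times> nat) list"
  show "p \<in> lattice_paths t l k n \<longleftrightarrow> p \<in> ?S"
  proof (cases p rule: rev_cases)
    case Nil
    then show ?thesis
      by (auto simp: lattice_paths_def)
  next
    case (snoc q s)
    have snoc_image: "q @ [s] \<in> (\<lambda>p. p @ [s']) ` L \<longleftrightarrow> s = s' \<and> q \<in> L" for s' L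
      by auto
    show ?thesis
      unfolding snoc by (cases s) (auto simp: snoc_image lattice_paths_def steps_def)
  qed
qed

lemma path_matrix_rec:
  "path_matrix t l a b n k = of_bool (k = 0 \<and> n = 0) +
     (if n = 0 then 0 else b n * path_matrix t l a b (n - 1) k) +
     (if k = 0 then 0 else
        (\<Sum>i | i \<le> l \<and> t + i \<le> n. a n i * path_matrix t l a b (n - (t + i)) (k - 1)))"
proof -
  let ?w = "path_weight t a b 0"
  let ?V = "if n = 0 then {} else (\<lambda>p. p @ [(0, 1)]) ` lattice_paths t l k (n - 1)"
  let ?D = "\<lambda>i. (\<lambda>p. p @ [(1, t + i)]) ` lattice_paths t l (k - 1) (n - (t + i))"
  let ?I = "{i. i \<le> l \<and> t + i \<le> n}"
  let ?H = "if k = 0 then {} else (\<Union>i\<in>?I. ?D i)"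
  have finI: "finite ?I"
    by simp
  have sumV: "sum ?w ?V = (if n = 0 then 0 else b n * path_matrix t l a b (n - 1) k)"
    by (auto simp: path_matrix_def sum.reindex inj_on_def path_weight_snoc sum_distrib_left
        lattice_paths_def step_weight_def mult.commute intro!: sum.cong)
  have sumD: "sum ?w (?D i) = a n i * path_matrix t l a b (n - (t + i)) (k - 1)" if "i \<in> ?I" for i
    using that
    by (auto simp: path_matrix_def sum.reindex inj_on_def path_weight_snoc sum_distrib_left
        lattice_paths_def step_weight_def mult.commute intro!: sum.cong)
  \<comment> \<open>The last step determines \<open>i\<close>, so the sets are disjoint.\<close>
  have "sum ?w (\<Union>i\<in>?I. ?D i) = (\<Sum>i\<in>?I. sum ?w (?D i))"
    using finI by (intro sum.UNION_disjoint) (auto simp: finite_lattice_paths)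
  then have sumH: "sum ?w ?H = (if k = 0 then 0 else
      (\<Sum>i\<in>?I. a n i * path_matrix t l a b (n - (t + i)) (k - 1)))"
    using sumD by simp
  have finH: "finite ?H" and finV: "finite ?V"
    using finI by (auto simp: finite_lattice_paths)
  have "path_matrix t l a b n k =
      sum ?w (((if k = 0 \<and> n = 0 then {[]} else {}) \<union> ?V) \<union> ?H)"
    unfolding path_matrix_def by (subst lattice_paths_rec) (rule refl)
  also have "\<dots> = sum ?w (if k = 0 \<and> n = 0 then {[]} else {}) + sum ?w ?V + sum ?w ?H"
    using finH finV by (subst sum.union_disjoint; (subst sum.union_disjoint)?) auto
  finally show ?thesis
    unfolding sumV sumH by simp
qed

text \<open>The recursion reads: row \<open>n\<close> of \<open>M\<close> is \<open>b n\<close>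
  times row \<open>n - 1\<close> plus row \<open>n\<close> of \<open>N\<close>. Unrolling it by
  induction on \<open>n\<close> produces the products of the \<open>b n\<close> that form
  \<open>vertical_matrix\<close>.\<close>

lemma path_matrix_factorization:
  fixes t l :: nat and a :: "nat \<Rightarrow> nat \<Rightarrow> 'a :: comm_ring_1" and b :: "nat \<Rightarrow> 'a"
  defines "M \<equiv> path_matrix t l a b"
  defines "N \<equiv> cons_unit_column (\<lambda>i j. \<Sum>s\<le>i. weight_matrix l a i s * shift_rows t M s j)"
  shows "M n k = (\<Sum>s\<le>n. vertical_matrix b n s * N s k)"
proof -
  \<comment> \<open>Substitute \<open>s = n - i\<close>. The remaining indices \<open>s\<close>
    contribute zero: the shifted rows vanish for \<open>s < t\<close>, the band of the weight matrix
    excludes \<open>s + l < n\<close>.\<close>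
  have weights: "(\<Sum>i | i \<le> l \<and> t + i \<le> n. a n i * M (n - (t + i)) k) =
      (\<Sum>s\<le>n. weight_matrix l a n s * shift_rows t M s k)" for n k
  proof (rule sum.reindex_bij_witness_not_neutral[where S' = "{}" and
        T' = "{s. s \<le> n \<and> (s < t \<or> s + l < n)}" and i = "\<lambda>s. n - s" and j = "\<lambda>i. n - i"])
  qed (auto simp: weight_matrix_def shift_rows_def add.commute)
  have rec: "M n k = (if n = 0 then 0 else b n * M (n - 1) k) + N n k" for n k
    unfolding M_def by (subst path_matrix_rec)
      (auto simp: N_def M_def[symmetric] weights cons_unit_column_def split: nat.split)
  show ?thesis
  proof (induction n)
    case 0
    show ?case
      by (subst rec) (simp add: vertical_matrix_def)
  next
    case (Suc n)
    \<comment> \<open>The old terms gain the factor \<open>b (Suc n)\<close>; the new term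
      \<open>s = Suc n\<close> has the empty product 1 as coefficient.\<close>
    have "vertical_matrix b (Suc n) s = b (Suc n) * vertical_matrix b n s" if "s \<le> n" for s
      using that by (simp add: vertical_matrix_def prod.nat_ivl_Suc' mult.commute)
    then have "(\<Sum>s\<le>n. vertical_matrix b (Suc n) s * N s k) = b (Suc n) * M n k"
      unfolding Suc.IH by (simp add: sum_distrib_left mult.assoc)
    then show ?case
      by (subst rec) (simp add: vertical_matrix_def)
  qed
qed

section \<open>Transfer from the weight matrix to the path matrix\<close>

context subsemiring
begin

text \<open>Total positivity of order \<open>r\<close> also requires the entries to be polynomials
  in the given variables, which for \<open>r = 0\<close> does not follow from the minors.\<close>

lemma path_matrix_closed:
  assumes a: "\<And>n i. i \<le> l \<Longrightarrow> a n i \<in> Q" and b: "\<And>n. b n \<in> Q"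
  shows "path_matrix t l a b n k \<in> Q"
proof -
  have "path_weight t a b h p \<in> Q" if "set p \<subseteq> steps t l" for h p
    using that
  proof (induction p arbitrary: h)
    case Nil
    then show ?case
      by (simp add: one_closed)
  next
    case (Cons s p)
    then show ?case
      by (auto simp: steps_def step_weight_def intro!: mult_closed a b)
  qed
  then show ?thesis
    by (auto simp: path_matrix_def lattice_paths_def intro!: sum_closed)
qed

text \<open>The factorization expresses the first \<open>K + 1\<close> columns of the path matrix by its first \<open>K\<close>
  columns; truncation makes this an induction on \<open>K\<close>.\<close>

lemma minors_in_path_matrix:
  assumes A: "minors_in Q r (weight_matrix l a)" and b: "\<And>n. b n \<in> Q"
  shows "minors_in Q r (path_matrix t l a b)"
proof (rule minors_inI)
  let ?M = "path_matrix t l a b"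
  have trunc: "minors_in Q r (\<lambda>n k. if k < K then ?M n k else 0)" for K
  proof (induction K)
    case 0
    show ?case
    proof (rule minors_inI)
      fix k and R C :: "nat \<Rightarrow> nat"
      show "minor (\<lambda>n k. if k < 0 then ?M n k else 0) k R C \<in> Q"
        \<comment> \<open>The zero matrix has only zero minors, except for the empty minor
          1.\<close>
        by (cases "k = 0") (auto simp: one_closed zero_closed minor_zero_row[of 0])
    qed
  next
    case (Suc K)
    let ?T = "\<lambda>n k. if k < K then ?M n k else 0"
    let ?N = "\<lambda>M. cons_unit_column (\<lambda>i j. \<Sum>s\<le>i. weight_matrix l a i s * shift_rows t M s j)"
    \<comment> \<open>Column \<open>Suc k\<close> of \<open>?N M\<close> depends only on column
      \<open>k\<close> of \<open>M\<close>, and column 0 is fixed, so truncating \<open>M\<close> at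
      \<open>K\<close> truncates \<open>?N M\<close> at \<open>Suc K\<close>.\<close>
    have trunc_column: "?N ?T s k = (if k < Suc K then ?N ?M s k else 0)" for s k
      by (auto simp: cons_unit_column_def shift_rows_def intro!: sum.cong sum.neutral split: nat.split)
    have "minors_in Q r (\<lambda>i j. \<Sum>s\<le>i. vertical_matrix b i s * ?N ?T s j)"
      by (intro minors_in_mult minors_in_vertical_matrix minors_in_cons_unit_column
          minors_in_shift_rows A b Suc.IH) (auto simp: vertical_matrix_def weight_matrix_def)
    also have "(\<lambda>i j. \<Sum>s\<le>i. vertical_matrix b i s * ?N ?T s j) =
        (\<lambda>n k. if k < Suc K then ?M n k else 0)"
      unfolding trunc_column by (intro ext) (simp add: path_matrix_factorization[of t l a b])
    finally show ?case .
  qed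
  fix k and R C :: "nat \<Rightarrow> nat"
  assume k: "k \<le> r" and R: "strict_mono_on {..<k} R" and C: "strict_mono_on {..<k} C"
  \<comment> \<open>This \<open>K\<close> exceeds every selected column, so the minor does not see
    the truncation.\<close>
  define K where "K = Suc (\<Sum>i<k. C i)"
  have "C i < K" if "i < k" for i
    using that member_le_sum[of i "{..<k}" C] by (simp add: K_def)
  then have "minor ?M k R C = minor (\<lambda>n k. if k < K then ?M n k else 0) k R C"
    by (intro minor_cong) simp
  also have "\<dots> \<in> Q"
    using trunc k R C by (rule minors_inD)
  finally show "minor ?M k R C \<in> Q" .
qed

end

section \<open>Polynomials with nonnegative coefficients\<close>

lemma polys_in_mono: "X \<subseteq> Z \<Longrightarrow> polys_in X \<subseteq> polys_in Z"
  by (auto simp: polys_in_def)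

text \<open>The coefficients of a convolution are sums of products of coefficients.\<close>

lemma nonneg_coeffs_mult:
  assumes "nonneg_coeffs p" "nonneg_coeffs q"
  shows "nonneg_coeffs (p * q)"
  using assms unfolding nonneg_coeffs_def lookup_mult
  by (auto simp: Sum_any.expand_set when_def intro!: sum_nonneg mult_nonneg_nonneg)

lemma polys_in_mult:
  assumes "p \<in> polys_in Z" "q \<in> polys_in Z"
  shows "p * q \<in> polys_in Z"
  unfolding polys_in_def
proof (intro CollectI ballI)
  fix m assume "m \<in> Poly_Mapping.keys (p * q)"
  then obtain u v where uv: "u \<in> Poly_Mapping.keys p" "v \<in> Poly_Mapping.keys q" "m = u + v"
    using keys_mult[of p q] by auto
  have "Poly_Mapping.keys m \<subseteq> Poly_Mapping.keys u \<union> Poly_Mapping.keys v"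
    unfolding uv(3) by (rule Poly_Mapping.keys_add)
  also have "\<dots> \<subseteq> Z"
    using assms uv by (simp add: polys_in_def)
  finally show "Poly_Mapping.keys m \<subseteq> Z" .
qed

lemma polys_in_add:
  assumes "p \<in> polys_in Z" "q \<in> polys_in Z"
  shows "p + q \<in> polys_in Z"
  unfolding polys_in_def
proof (intro CollectI ballI)
  fix m assume "m \<in> Poly_Mapping.keys (p + q)"
  then have "m \<in> Poly_Mapping.keys p \<union> Poly_Mapping.keys q"
    using Poly_Mapping.keys_add[of p q] by (rule rev_subsetD)
  then show "Poly_Mapping.keys m \<subseteq> Z"
    using assms by (auto simp: polys_in_def)
qed

lemma subsemiring_nonneg_polys: "subsemiring {p \<in> polys_in Z. nonneg_coeffs p}"
proof
  fix p q assume "p \<in> {p \<in> polys_in Z. nonneg_coeffs p}" "q \<in> {p \<in> polys_in Z. nonneg_coeffs p}"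
  then show "p + q \<in> {p \<in> polys_in Z. nonneg_coeffs p}"
    "p * q \<in> {p \<in> polys_in Z. nonneg_coeffs p}"
    using polys_in_add[of p Z q] polys_in_mult[of p Z q] nonneg_coeffs_mult[of p q]
    by (simp_all add: nonneg_coeffs_def lookup_add)
qed (auto simp: polys_in_def nonneg_coeffs_def lookup_one when_def)

lemma totally_positive_of_order_iff_minors_in:
  "totally_positive_of_order Z r A \<longleftrightarrow>
     (\<forall>i j. A i j \<in> polys_in Z) \<and> minors_in {p \<in> polys_in Z. nonneg_coeffs p} r A"
  by (auto simp: totally_positive_of_order_def minors_in_def)

text \<open>A minor of order \<open>k\<close> is covered by the choice \<open>r = k\<close>. This
  reduces the second claim of the theorem to the first.\<close>

lemma totally_positive_iff_all_orders:
  "totally_positive Z A \<longleftrightarrow> (\<forall>r. totally_positive_of_order Z r A)"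
  unfolding totally_positive_def totally_positive_of_order_def by (meson order_refl)

theorem theorem1p3:
  fixes X Y :: "'v set"
    and t l r :: nat
    and a :: "nat \<Rightarrow> nat \<Rightarrow> 'v rpoly"
    and b :: "nat \<Rightarrow> 'v rpoly"
  assumes "\<And>n i. i \<le> l \<Longrightarrow> a n i \<in> polys_in X \<and> nonneg_coeffs (a n i)"
    and "\<And>n. b n \<in> polys_in Y \<and> nonneg_coeffs (b n)"
  shows "(totally_positive_of_order X r (weight_matrix l a) \<longrightarrow>
            totally_positive_of_order (X \<union> Y) r (path_matrix t l a b)) \<and>
         (totally_positive X (weight_matrix l a) \<longrightarrow>
            totally_positive (X \<union> Y) (path_matrix t l a b))"
proof -
  let ?Q = "{p \<in> polys_in (X \<union> Y). nonneg_coeffs p}"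
  interpret subsemiring ?Q
    by (rule subsemiring_nonneg_polys)
  have XQ: "{p \<in> polys_in X. nonneg_coeffs p} \<subseteq> ?Q"
    using polys_in_mono[of X "X \<union> Y"] by auto
  have a: "a n i \<in> ?Q" if "i \<le> l" for n i
    using assms(1)[OF that] XQ by blast
  have b: "b n \<in> ?Q" for n
    using assms(2) polys_in_mono[of Y "X \<union> Y"] by blast
  \<comment> \<open>This is shown for every \<open>r\<close>, not only the fixed one, since total
    positivity needs all orders.\<close>
  have order: "totally_positive_of_order (X \<union> Y) r (path_matrix t l a b)"
    if "totally_positive_of_order X r (weight_matrix l a)" for r
  proof -
    have "minors_in ?Q r (weight_matrix l a)"
      using that minors_in_mono[OF XQ] by (simp add: totally_positive_of_order_iff_minors_in)
    then show ?thesis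
      using minors_in_path_matrix path_matrix_closed[of l a b] a b
      by (auto simp: totally_positive_of_order_iff_minors_in)
  qed
  then show ?thesis
    by (auto simp: totally_positive_iff_all_orders)
qed

end
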